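(* Let $\mathcal{E}$ be a 1-dimensional exponential family defined over a finite set $\Omega=\{x_0,\dots,x_m\}$ (with the counting measure). If the scalar curvature of $T\mathcal{E}$ is constant and equal to $\lambda$, then $$\lambda\in\Big\{\frac{2}{k}\;\Big|\;k\in\mathbb{Z},\ 1\leq k\leq m\Big\}.$$
   Context: A 1-dimensional exponential family $\mathcal{E}$ over a finite set $\Omega=\{x_0,\dots,x_m\}$ with the counting measure is a set of probability functions $p(x;\theta)=\exp\{C(x)+\theta F(x)-\psi(\theta)\}$, $\theta\in\mathbb{R}$, where $C,F:\Omega\to\mathbb{R}$ and $F$ is assumed linearly independent from the constant function $1$ (i.e. $F$ is not constant). Normalization forces $\psi(\theta)=\ln\sum_{k=0}^m e^{C(x_k)+\theta F(x_k)}$. The parameter $\theta$ is a global chart, making $\mathcal{E}$ a 1-dimensional manifold. The Fisher metric on $\mathcal{E}$ is given by $h_F(\theta)=\sum_{x\in\Omega}(\partial_\theta\ln p(x;\theta))^2\,p(x;\theta)=\psi''(\theta)$. The exponential connection $\nabla^{(e)}$ is the flat connection for which $\theta$ is an affine coordinate. Let $(q,r)$ be the coordinates on $T\mathcal{E}$ for which $(q,r)$ represents the tangent vector $r\,\frac{\partial}{\partial\theta}$ at the point $\theta=q$. The Kähler metric on $T\mathcal{E}$ associated to $(h_F,\nabla^{(e)})$ by Dombrowski's construction is $g=h_F(q)(dq^2+dr^2)$. The scalar curvature of $T\mathcal{E}$ is the scalar curvature (trace of the Ricci tensor) of $g$; explicitly $\mathrm{Scal}(q,r)=-\frac{1}{h_F(q)}\frac{d^2}{dq^2}\ln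 h_F(q)$. *)

theory Defs
  imports "HOL-Analysis.Analysis"
begin

text \<open>
  The log-normalizer and the densities of the family
  \<open>p(x;\<theta>) = exp (C x + \<theta> F x - \<psi>(\<theta>))\<close> over a finite set with the counting measure.
\<close>

definition log_normalizer :: "'a set \<Rightarrow> ('a \<Rightarrow> real) \<Rightarrow> ('a \<Rightarrow> real) \<Rightarrow> real \<Rightarrow> real" where
  "log_normalizer \<Omega> C F \<theta> = ln (\<Sum>x\<in>\<Omega>. exp (C x + \<theta> * F x))"

definition density_at :: "'a set \<Rightarrow> ('a \<Rightarrow> real) \<Rightarrow> ('a \<Rightarrow> real) \<Rightarrow> real \<Rightarrow> 'a \<Rightarrow> real" where
  "density_at \<Omega> C F \<theta> x = exp (C x + \<theta> * F x - log_normalizer \<Omega> C F \<theta>)"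

text \<open>
  The triple \<open>(\<Omega>, C, F)\<close> presents a one-dimensional exponential family, the set of all
  \<open>density_at \<Omega> C F \<theta>\<close> with \<open>\<theta>\<close> real, when \<open>F\<close> and the constant function \<open>1\<close> are linearly
  independent on \<open>\<Omega>\<close>; then \<open>\<theta>\<close> is a global chart.
\<close>

definition exponential_family_1 :: "'a set \<Rightarrow> ('a \<Rightarrow> real) \<Rightarrow> ('a \<Rightarrow> real) \<Rightarrow> bool" where
  "exponential_family_1 \<Omega> C F \<longleftrightarrow>
     finite \<Omega> \<and> (\<forall>a b. (\<forall>x\<in>\<Omega>. a * F x + b * 1 = 0) \<longrightarrow> a = 0 \<and> b = 0)"

definition fisher_metric :: "'a set \<Rightarrow> ('a \<Rightarrow> real) \<Rightarrow> ('a \<Rightarrow> real) \<Rightarrow> real \<Rightarrow> real" where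
  "fisher_metric \<Omega> C F \<theta> =
     (\<Sum>x\<in>\<Omega>. (deriv (\<lambda>t. ln (density_at \<Omega> C F t x)) \<theta>)\<^sup>2 * density_at \<Omega> C F \<theta> x)"

text \<open>
  Riemannian metrics on the coordinate space are given by their matrices \<open>g\<^sub>i\<^sub>j\<close>.  The definitions
  below use the classical coordinate formulas (and are meant for smooth, pointwise invertible \<open>g\<close>).
\<close>

definition partial_deriv :: "'n::finite \<Rightarrow> (real^'n \<Rightarrow> real) \<Rightarrow> real^'n \<Rightarrow> real" where
  "partial_deriv i f x = deriv (\<lambda>t. f (x + t *\<^sub>R axis i 1)) 0"

text \<open>\<open>christoffel g k i j\<close> is \<open>\<Gamma>\<^sup>k\<^sub>i\<^sub>j\<close> of the Levi-Civita connection.\<close>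

definition christoffel ::
    "(real^'n \<Rightarrow> real^'n^'n) \<Rightarrow> 'n::finite \<Rightarrow> 'n \<Rightarrow> 'n \<Rightarrow> real^'n \<Rightarrow> real" where
  "christoffel g k i j x =
     (\<Sum>l\<in>UNIV. matrix_inv (g x) $ k $ l *
        (partial_deriv i (\<lambda>y. g y $ j $ l) x + partial_deriv j (\<lambda>y. g y $ i $ l) x
          - partial_deriv l (\<lambda>y. g y $ i $ j) x)) / 2"

text \<open>
  \<open>riemann g l i j k\<close> is the component along \<open>\<partial>\<^sub>l\<close> of \<open>R(\<partial>\<^sub>i, \<partial>\<^sub>j) \<partial>\<^sub>k\<close>, where
  \<open>R(X,Y) = \<nabla>\<^sub>X \<nabla>\<^sub>Y - \<nabla>\<^sub>Y \<nabla>\<^sub>X - \<nabla>\<^sub>[\<^sub>X\<^sub>,\<^sub>Y\<^sub>]\<close>, and \<open>Ric(Y,Z)\<close> is the trace of \<open>X \<mapsto> R(X,Y) Z\<close>;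
  with these signs round spheres have positive scalar curvature.
\<close>

definition riemann ::
    "(real^'n \<Rightarrow> real^'n^'n) \<Rightarrow> 'n::finite \<Rightarrow> 'n \<Rightarrow> 'n \<Rightarrow> 'n \<Rightarrow> real^'n \<Rightarrow> real" where
  "riemann g l i j k x =
     partial_deriv i (christoffel g l j k) x - partial_deriv j (christoffel g l i k) x
     + (\<Sum>s\<in>UNIV. christoffel g l i s x * christoffel g s j k x
                 - christoffel g l j s x * christoffel g s i k x)"

definition ricci :: "(real^'n \<Rightarrow> real^'n^'n) \<Rightarrow> 'n::finite \<Rightarrow> 'n \<Rightarrow> real^'n \<Rightarrow> real" where
  "ricci g j k x = (\<Sum>i\<in>UNIV. riemann g i i j k x)"

definition scalar_curvature :: "(real^'n::finite \<Rightarrow> real^'n^'n) \<Rightarrow> real^'n \<Rightarrow> real" where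
  "scalar_curvature g x = (\<Sum>j\<in>UNIV. \<Sum>k\<in>UNIV. matrix_inv (g x) $ j $ k * ricci g j k x)"

text \<open>
  A point \<open>(q, r)\<close> of \<open>real^2\<close> stands for the tangent vector \<open>r \<partial>/\<partial>\<theta>\<close> at \<open>\<theta> = q\<close>.  As \<open>\<theta>\<close> is affine
  for the exponential connection, Dombrowski's metric is \<open>h(q) (dq\<^sup>2 + dr\<^sup>2)\<close>, with matrix
  \<open>h(q)\<close> times the identity.
\<close>

definition dombrowski_metric :: "(real \<Rightarrow> real) \<Rightarrow> real^2 \<Rightarrow> real^2^2" where
  "dombrowski_metric h v = mat (h (v $ 1))"

definition scal_tangent_bundle ::
    "'a set \<Rightarrow> ('a \<Rightarrow> real) \<Rightarrow> ('a \<Rightarrow> real) \<Rightarrow> real \<Rightarrow> real \<Rightarrow> real" where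
  "scal_tangent_bundle \<Omega> C F q r =
     scalar_curvature (dombrowski_metric (fisher_metric \<Omega> C F)) (vector [q, r])"

end

theory Submission
  imports Defs
begin

text \<open>
  Write \<open>\<mu> = \<psi>'\<close> for the mean of \<open>F\<close>, so that \<open>h = \<mu>'\<close> is the Fisher metric.  Constant scalar
  curvature \<open>\<lambda>\<close> means \<open>(ln h)'' = - \<lambda> h = - \<lambda> \<mu>'\<close>; integrating twice gives the Riccati equation
  \<open>\<mu>' = c + a \<mu> - \<lambda> \<mu>\<^sup>2 / 2\<close>.  If \<open>\<lambda> \<le> 0\<close> then \<open>ln h\<close> is convex, so \<open>h\<close> is bounded below by a positive
  constant on a half line, which contradicts the boundedness of \<open>\<mu>\<close>.  So \<open>\<lambda> > 0\<close>, the quadratic has two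
  real roots \<open>r1 < \<mu> < r2\<close>, and with \<open>\<delta> = \<lambda> (r2 - r1) / 2\<close> the equation integrates to
  \<open>\<mu> - r1 = K exp (\<delta> \<theta>) (r2 - \<mu>)\<close>.  Multiplied by \<open>exp \<psi>\<close> this is a linear relation between the
  exponentials \<open>exp (\<theta> F x)\<close> and \<open>exp (\<theta> (F x + \<delta>))\<close>.  Comparing coefficients, the set of values of
  \<open>F\<close> contains \<open>f - \<delta>\<close> with every \<open>f \<noteq> r1\<close> and \<open>f + \<delta>\<close> with every \<open>f \<noteq> r2\<close>.  Being finite, it contains
  the progression from \<open>r1\<close> to \<open>r2\<close> with step \<open>\<delta>\<close>, whence \<open>r2 - r1 = k \<delta>\<close>, that is \<open>\<lambda> = 2 / k\<close>.
\<close>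

section \<open>Linear independence of exponentials\<close>

text \<open>Induction on \<open>S\<close>: multiplying by \<open>exp (- \<theta> * r)\<close> makes
  the term of the new exponent \<open>r\<close> constant. Differentiation then removes it and
  multiplies every other coefficient by the nonzero factor \<open>s - r\<close>.\<close>

lemma exp_sum_eq_0_imp_coeff_eq_0:
  fixes d :: "real \<Rightarrow> real"
  assumes "finite S" and "\<And>\<theta>. (\<Sum>s\<in>S. d s * exp (\<theta> * s)) = 0" and "s \<in> S"
  shows "d s = 0"
  using assms
proof (induction S arbitrary: d s rule: finite_induct)
  case empty
  then show ?case by simp
next
  case (insert r S)
  have sum_shift: "d r + (\<Sum>s\<in>S. d s * exp (\<theta> * (s - r))) = 0" for \<theta>
  proof -
    have "(\<Sum>s\<in>insert r S. d s * exp (\<theta> * s)) * exp (- \<theta> * r) = 0"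
      using insert.prems(1) by simp
    moreover have "(\<Sum>s\<in>insert r S. d s * exp (\<theta> * s)) * exp (- \<theta> * r)
        = (\<Sum>s\<in>insert r S. d s * exp (\<theta> * (s - r)))"
      by (auto simp: sum_distrib_right mult_exp_exp right_diff_distrib simp del: sum.insert
          intro!: sum.cong)
    ultimately show ?thesis
      using insert.hyps by simp
  qed
  have "(\<Sum>s\<in>S. d s * (s - r) * exp (\<theta> * s)) = 0" for \<theta>
  proof -
    have exp_shift: "exp (\<theta> * (s - r)) * exp (\<theta> * r) = exp (\<theta> * s)" for s
      by (simp add: mult_exp_exp right_diff_distrib)
    have "((\<lambda>\<theta>. d r + (\<Sum>s\<in>S. d s * exp (\<theta> * (s - r)))) has_real_derivative
        (\<Sum>s\<in>S. d s * (s - r) * exp (\<theta> * (s - r)))) (at \<theta>)"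
      by (auto intro!: derivative_eq_intros sum.cong)
    then have "(\<Sum>s\<in>S. d s * (s - r) * exp (\<theta> * (s - r))) = 0"
      unfolding sum_shift by (metis DERIV_const DERIV_unique)
    then have "(\<Sum>s\<in>S. d s * (s - r) * exp (\<theta> * (s - r))) * exp (\<theta> * r) = 0"
      by simp
    moreover have "(\<Sum>s\<in>S. d s * (s - r) * exp (\<theta> * (s - r))) * exp (\<theta> * r)
        = (\<Sum>s\<in>S. d s * (s - r) * exp (\<theta> * s))"
      by (simp add: sum_distrib_right mult.assoc exp_shift)
    ultimately show ?thesis by simp
  qed
  then have "d t * (t - r) = 0" if "t \<in> S" for t
    using insert.IH [of "\<lambda>s. d s * (s - r)"] that by blast
  then have "d t = 0" if "t \<in> S" for t
    using that insert.hyps by fastforce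
  moreover from this have "d r = 0"
    using sum_shift [of 0] by simp
  ultimately show ?case
    using insert.prems(2) by blast
qed

text \<open>Indices with equal exponents cannot be separated, so coefficients are compared only
  after summing over the fibers of \<open>g\<close>.\<close>

lemma exp_sum_eq_0_imp_fiber_sum_eq_0:
  fixes d g :: "'i \<Rightarrow> real"
  assumes fin: "finite I" and zero: "\<And>\<theta>. (\<Sum>i\<in>I. d i * exp (\<theta> * g i)) = 0"
  shows "(\<Sum>i\<in>{i\<in>I. g i = t}. d i) = 0"
proof (cases "t \<in> g ` I")
  case True
  have "(\<Sum>s\<in>g ` I. (\<Sum>i\<in>{i\<in>I. g i = s}. d i) * exp (\<theta> * s)) = 0" for \<theta>
  proof -
    have "(\<Sum>s\<in>g ` I. (\<Sum>i\<in>{i\<in>I. g i = s}. d i) * exp (\<theta> * s))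
        = (\<Sum>s\<in>g ` I. \<Sum>i\<in>{i\<in>I. g i = s}. d i * exp (\<theta> * g i))"
      by (auto simp: sum_distrib_right intro!: sum.cong)
    also have "\<dots> = (\<Sum>i\<in>I. d i * exp (\<theta> * g i))"
      by (rule sum.image_gen [OF fin, symmetric])
    finally show ?thesis using zero by simp
  qed
  from exp_sum_eq_0_imp_coeff_eq_0 [OF finite_imageI [OF fin] this True] show ?thesis .
next
  case False
  then have "{i\<in>I. g i = t} = {}" by blast
  then show ?thesis by (simp only: sum.empty)
qed

text \<open>The minimum of \<open>S\<close> cannot step down, so it is the exempt point
  \<open>a\<close>. Steps up from \<open>a\<close> stay in \<open>S\<close> until \<open>b\<close>
  is met, and finiteness forces this to happen.\<close>

lemma finite_progression:
  fixes S :: "real set"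
  assumes "finite S" "S \<noteq> {}" "\<delta> > 0"
    and up: "\<And>f. f \<in> S \<Longrightarrow> f \<noteq> b \<Longrightarrow> f + \<delta> \<in> S"
    and down: "\<And>f. f \<in> S \<Longrightarrow> f \<noteq> a \<Longrightarrow> f - \<delta> \<in> S"
  obtains k :: nat where "b = a + real k * \<delta>" "k + 1 \<le> card S"
proof -
  have "Min S \<in> S" using assms by simp
  moreover have "Min S - \<delta> \<notin> S"
    using Min_le [OF \<open>finite S\<close>, of "Min S - \<delta>"] \<open>\<delta> > 0\<close> by auto
  ultimately have "a \<in> S" using down [of "Min S"] by auto
  have inj: "inj (\<lambda>n. a + real n * \<delta>)"
    using \<open>\<delta> > 0\<close> by (auto simp: inj_on_def)
  have run: "a + real n * \<delta> \<in> S" if "\<forall>i<n. b \<noteq> a + real i * \<delta>" for n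
    using that
  proof (induction n)
    case 0
    then show ?case using \<open>a \<in> S\<close> by simp
  next
    case (Suc n)
    then have "a + real n * \<delta> + \<delta> \<in> S"
      by (intro up) auto
    then show ?case by (simp add: algebra_simps)
  qed
  have "\<exists>k. b = a + real k * \<delta>"
  proof (rule ccontr)
    assume "\<not> ?thesis"
    then have "range (\<lambda>n. a + real n * \<delta>) \<subseteq> S" using run by blast
    then have "finite (range (\<lambda>n. a + real n * \<delta>))"
      using \<open>finite S\<close> by (rule finite_subset)
    then show False
      using range_inj_infinite [OF inj] by contradiction
  qed
  \<comment> \<open>Taking the least \<open>k\<close> keeps all earlier terms different from
    \<open>b\<close>. Since \<open>run\<close> constrains only indices below \<open>n\<close>, it
    covers \<open>n = k\<close> too, which gives \<open>k + 1\<close> points.\<close>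
  then obtain k where k: "b = a + real k * \<delta>" "\<forall>i<k. b \<noteq> a + real i * \<delta>"
    unfolding exists_least_iff [of "\<lambda>k. b = a + real k * \<delta>"] by (elim exE conjE)
  have "(\<lambda>n. a + real n * \<delta>) ` {..k} \<subseteq> S"
  proof (rule image_subsetI)
    fix n assume "n \<in> {..k}"
    then show "a + real n * \<delta> \<in> S" using k(2) by (intro run) simp
  qed
  then have "card ((\<lambda>n. a + real n * \<delta>) ` {..k}) \<le> card S"
    by (rule card_mono [OF \<open>finite S\<close>])
  moreover have "card ((\<lambda>n. a + real n * \<delta>) ` {..k}) = k + 1"
    using card_image [OF inj_on_subset [OF inj subset_UNIV], of "{..k}"] by simp
  ultimately have "k + 1 \<le> card S" by (simp only:)
  with k(1) show thesis by (rule that)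
qed

section \<open>Scalar curvature of a conformal metric depending on one coordinate\<close>

text \<open>\<open>matrix_inv\<close> is a choice operator, so the two-sided inverse must also be
  shown unique.\<close>

lemma matrix_inv_mat:
  fixes a :: real
  assumes "a \<noteq> 0"
  shows "matrix_inv (mat a :: real^'n^'n) = mat (1 / a)"
proof -
  have prod: "(mat b :: real^'n^'n) ** mat c = mat (b * c)" for b c :: real
  proof -
    have "(if i = k then b else 0) * (if k = j then c else 0)
        = (if k = i then if i = j then b * c else 0 else 0)" for i j k :: 'n
      by simp
    then show ?thesis
      by (simp add: vec_eq_iff matrix_matrix_mult_def mat_def)
  qed
  have "(mat a :: real^'n^'n) ** mat (1 / a) = mat 1 \<and> (mat (1 / a) :: real^'n^'n) ** mat a = mat 1"
    using assms by (simp add: prod)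
  moreover have "B = mat (1 / a)"
    if "(mat a :: real^'n^'n) ** B = mat 1 \<and> B ** (mat a :: real^'n^'n) = mat 1" for B
  proof -
    have "B = (mat (1 / a) ** mat a) ** B"
      using assms by (simp add: prod)
    also have "\<dots> = mat (1 / a) ** (mat a ** B)"
      by (simp only: matrix_mul_assoc)
    also have "\<dots> = mat (1 / a)"
      using that by simp
    finally show ?thesis .
  qed
  ultimately show ?thesis
    unfolding matrix_inv_def by (rule some_equality)
qed

lemma partial_deriv_first_coordinate:
  fixes f :: "real \<Rightarrow> real" and x :: "real^2"
  shows "partial_deriv i (\<lambda>y. f (y $ 1)) x = (if i = 1 then deriv f (x $ 1) else 0)"
proof (cases "i = 1")
  case True
  have "((\<lambda>t. f (x $ 1 + t)) has_field_derivative D) (at 0)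
      \<longleftrightarrow> (f has_field_derivative D) (at (x $ 1))" for D
    using DERIV_shift [of f D 0 "x $ 1"] by (simp add: add.commute)
  then show ?thesis using True
    by (simp add: partial_deriv_def deriv_def axis_def)
next
  case False
  then show ?thesis
    by (simp add: partial_deriv_def axis_def)
qed

text \<open>The right-hand side is \<open>- (ln h)'' / h\<close> written out.\<close>

lemma scalar_curvature_conformal:
  fixes h h1 h2 :: "real \<Rightarrow> real"
  assumes pos: "\<And>t. h t > 0"
    and h1: "\<And>t. (h has_real_derivative h1 t) (at t)"
    and h2: "\<And>t. (h1 has_real_derivative h2 t) (at t)"
  shows "scalar_curvature (dombrowski_metric h) x
    = ((h1 (x $ 1))\<^sup>2 - h (x $ 1) * h2 (x $ 1)) / (h (x $ 1)) ^ 3"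
proof -
  let ?g = "dombrowski_metric h"
  \<comment> \<open>Half the logarithmic derivative of \<open>h\<close>; every Christoffel symbol is
    \<open>0\<close>, \<open>\<gamma>\<close> or \<open>- \<gamma>\<close>.\<close>
  define \<gamma> where "\<gamma> = (\<lambda>t. h1 t / (2 * h t))"
  have nz: "h t \<noteq> 0" for t using pos [of t] by simp
  have dh: "deriv h t = h1 t" for t using h1 DERIV_imp_deriv by blast
  have inv: "matrix_inv (?g y) = mat (1 / h (y $ 1))" for y
    unfolding dombrowski_metric_def by (rule matrix_inv_mat [OF nz])
  have dg: "partial_deriv i (\<lambda>y. ?g y $ j $ l) y
      = (if i = 1 \<and> j = l then h1 (y $ 1) else 0)" for i j l y
    using partial_deriv_first_coordinate [of i "\<lambda>t. if j = l then h t else 0" y]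
    by (simp add: dombrowski_metric_def mat_def dh)
  have chr: "christoffel ?g k i j = (\<lambda>y. (if i = 1 \<and> j = k then \<gamma> (y $ 1) else 0)
      + (if j = 1 \<and> i = k then \<gamma> (y $ 1) else 0)
      - (if k = 1 \<and> i = j then \<gamma> (y $ 1) else 0))" for k i j
    using exhaust_2 [of i] exhaust_2 [of j] exhaust_2 [of k] nz
    by (auto simp: fun_eq_iff christoffel_def inv dg sum_2 mat_def \<gamma>_def field_simps)
  have "((\<lambda>t. h1 t / (2 * h t)) has_real_derivative
      (h2 t * h t - (h1 t)\<^sup>2) / (2 * (h t)\<^sup>2)) (at t)" for t
    using nz by (auto intro!: derivative_eq_intros h1 h2 simp: field_simps power2_eq_square)
  then have \<gamma>: "(\<gamma> has_real_derivative (h2 t * h t - (h1 t)\<^sup>2) / (2 * (h t)\<^sup>2)) (at t)" for t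
    unfolding \<gamma>_def .
  then have d\<gamma>: "deriv \<gamma> t = (h2 t * h t - (h1 t)\<^sup>2) / (2 * (h t)\<^sup>2)" for t
    by (rule DERIV_imp_deriv)
  have d\<gamma>': "deriv (\<lambda>t. - \<gamma> t) t = - deriv \<gamma> t" for t
    unfolding d\<gamma> by (rule DERIV_imp_deriv [OF DERIV_minus [OF \<gamma>]])
  have pd: "partial_deriv i (\<lambda>y. \<gamma> (y $ 1)) y = (if i = 1 then deriv \<gamma> (y $ 1) else 0)"
    "partial_deriv i (\<lambda>y. - \<gamma> (y $ 1)) y = (if i = 1 then - deriv \<gamma> (y $ 1) else 0)"
    "partial_deriv i (\<lambda>y. 0) y = 0" for i and y :: "real^2"
    using partial_deriv_first_coordinate [of i \<gamma> y]
      partial_deriv_first_coordinate [of i "\<lambda>t. - \<gamma> t" y]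
      partial_deriv_first_coordinate [of i "\<lambda>t. 0" y]
    by (auto simp: d\<gamma>')
  show ?thesis
    using nz [of "x $ 1"]
    by (simp add: scalar_curvature_def ricci_def riemann_def inv chr pd sum_2 mat_def)
      (simp add: d\<gamma> field_simps power2_eq_square power3_eq_cube)
qed

section \<open>Moments of an exponential family\<close>

lemma zero_derivative_imp_constant:
  fixes f :: "real \<Rightarrow> real"
  assumes "\<And>x. (f has_real_derivative 0) (at x)"
  obtains c where "\<And>x. f x = c"
  using that [of "f 0"] DERIV_isconst_all [of f _ 0] assms by blast

declare One_nat_def [simp del]

locale nonconstant_statistic =
  fixes \<Omega> :: "'a set" and C F :: "'a \<Rightarrow> real"
  assumes finite: "finite \<Omega>" and nonconstant: "\<And>c. \<exists>x\<in>\<Omega>. F x \<noteq> c"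
begin

text \<open>Unnormalized moments: \<open>moment 0\<close> is \<open>exp \<psi>\<close>, and
  \<open>moment n\<close> is its \<open>n\<close>-th derivative.\<close>

definition moment :: "nat \<Rightarrow> real \<Rightarrow> real" where
  "moment n \<theta> = (\<Sum>x\<in>\<Omega>. F x ^ n * exp (C x + \<theta> * F x))"

definition mean :: "nat \<Rightarrow> real \<Rightarrow> real" where
  "mean n \<theta> = moment n \<theta> / moment 0 \<theta>"

text \<open>The variance of \<open>F\<close>, which is \<open>\<psi>''\<close>.\<close>

definition fisher :: "real \<Rightarrow> real" where
  "fisher \<theta> = mean 2 \<theta> - (mean 1 \<theta>)\<^sup>2"

lemma moment_0_pos: "moment 0 \<theta> > 0"
  unfolding moment_def using finite nonconstant by (auto intro!: sum_pos)

lemma moment_0_nonzero [simp]: "moment 0 \<theta> \<noteq> 0"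
  using moment_0_pos [of \<theta>] by simp

lemma has_derivative_moment:
  "(moment n has_real_derivative moment (Suc n) \<theta>) (at \<theta>)"
  unfolding moment_def
  by (auto intro!: derivative_eq_intros sum.cong)

lemma has_derivative_moment_0: "(moment 0 has_real_derivative moment 1 \<theta>) (at \<theta>)"
  using has_derivative_moment [of 0] by (simp add: One_nat_def)

lemma has_derivative_mean:
  "(mean n has_real_derivative mean (Suc n) \<theta> - mean n \<theta> * mean 1 \<theta>) (at \<theta>)"
  unfolding mean_def
  by (rule derivative_eq_intros refl has_derivative_moment has_derivative_moment_0 moment_0_nonzero)+
    (simp add: field_simps)

lemma has_derivative_mean_1: "(mean 1 has_real_derivative fisher \<theta>) (at \<theta>)"
  using has_derivative_mean [of 1] by (simp add: fisher_def power2_eq_square)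

lemma has_derivative_mean_2:
  "(mean 2 has_real_derivative mean 3 \<theta> - mean 2 \<theta> * mean 1 \<theta>) (at \<theta>)"
  using has_derivative_mean [of 2] by simp

text \<open>The third cumulant of \<open>F\<close>, in the form that the product rule
  delivers.\<close>

definition fisher' :: "real \<Rightarrow> real" where
  "fisher' \<theta> = mean 3 \<theta> - mean 2 \<theta> * mean 1 \<theta> - 2 * mean 1 \<theta> * fisher \<theta>"

lemma has_derivative_fisher: "(fisher has_real_derivative fisher' \<theta>) (at \<theta>)"
  unfolding fisher_def [abs_def] fisher'_def
  by (rule derivative_eq_intros refl has_derivative_mean_1 has_derivative_mean_2)+
    (simp add: fisher_def algebra_simps)

text \<open>Existence suffices: the curvature equation will determine
  \<open>fisher''\<close>.\<close>

lemma has_derivative_fisher':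
  obtains fisher'' where "\<And>\<theta>. (fisher' has_real_derivative fisher'' \<theta>) (at \<theta>)"
proof -
  have "\<exists>D. (fisher' has_real_derivative D) (at \<theta>)" for \<theta>
    unfolding fisher'_def [abs_def]
    by (rule exI, (rule derivative_intros has_derivative_mean has_derivative_fisher)+)
  then show thesis using that by metis
qed

section \<open>The Fisher metric as the variance of \<open>F\<close>\<close>

lemma log_normalizer_eq: "log_normalizer \<Omega> C F \<theta> = ln (moment 0 \<theta>)"
  by (simp add: log_normalizer_def moment_def)

lemma density_at_eq: "density_at \<Omega> C F \<theta> x = exp (C x + \<theta> * F x) / moment 0 \<theta>"
  using moment_0_pos by (simp add: density_at_def log_normalizer_eq exp_diff)

lemma fisher_metric_eq_sum:
  "fisher_metric \<Omega> C F \<theta> = (\<Sum>x\<in>\<Omega>. (F x - mean 1 \<theta>)\<^sup>2 * density_at \<Omega> C F \<theta> x)"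
proof -
  have "deriv (\<lambda>t. ln (density_at \<Omega> C F t x)) \<theta> = F x - mean 1 \<theta>" for x
  proof (rule DERIV_imp_deriv)
    show "((\<lambda>t. ln (density_at \<Omega> C F t x)) has_real_derivative F x - mean 1 \<theta>) (at \<theta>)"
      unfolding density_at_def log_normalizer_eq mean_def ln_exp
      using moment_0_pos [of \<theta>]
      by (auto intro!: derivative_eq_intros has_derivative_moment_0)
  qed
  then show ?thesis by (simp add: fisher_metric_def)
qed

lemma fisher_metric_eq: "fisher_metric \<Omega> C F = fisher"
proof
  fix \<theta>
  have "fisher_metric \<Omega> C F \<theta> * moment 0 \<theta>
      = (\<Sum>x\<in>\<Omega>. (F x - mean 1 \<theta>)\<^sup>2 * exp (C x + \<theta> * F x))"
    by (simp add: fisher_metric_eq_sum density_at_eq sum_distrib_right)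
  also have "\<dots> = (\<Sum>x\<in>\<Omega>. (F x)\<^sup>2 * exp (C x + \<theta> * F x)
      - 2 * mean 1 \<theta> * (F x * exp (C x + \<theta> * F x)) + (mean 1 \<theta>)\<^sup>2 * exp (C x + \<theta> * F x))"
    by (intro sum.cong refl) (simp add: power2_eq_square algebra_simps)
  also have "\<dots> = moment 2 \<theta> - 2 * mean 1 \<theta> * moment 1 \<theta> + (mean 1 \<theta>)\<^sup>2 * moment 0 \<theta>"
    by (simp add: moment_def sum.distrib sum_subtractf sum_distrib_left)
  also have "\<dots> = fisher \<theta> * moment 0 \<theta>"
    by (simp add: fisher_def mean_def field_simps power2_eq_square)
  finally show "fisher_metric \<Omega> C F \<theta> = fisher \<theta>" by simp
qed

text \<open>All densities are positive, so the variance could vanish only if \<open>F\<close>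
  equalled its mean on all of \<open>\<Omega>\<close>.\<close>

lemma fisher_pos: "fisher \<theta> > 0"
proof -
  obtain x where "x \<in> \<Omega>" "F x \<noteq> mean 1 \<theta>" using nonconstant by blast
  then have "0 < (\<Sum>x\<in>\<Omega>. (F x - mean 1 \<theta>)\<^sup>2 * density_at \<Omega> C F \<theta> x)"
    using finite by (intro sum_pos2 [of _ x]) (auto simp: density_at_def)
  then show ?thesis by (simp add: fisher_metric_eq_sum flip: fisher_metric_eq)
qed

lemma abs_mean_1_le: "\<bar>mean 1 \<theta>\<bar> \<le> (\<Sum>x\<in>\<Omega>. \<bar>F x\<bar>)"
proof -
  have "\<bar>moment 1 \<theta>\<bar> \<le> (\<Sum>x\<in>\<Omega>. \<bar>F x ^ 1 * exp (C x + \<theta> * F x)\<bar>)"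
    unfolding moment_def by (rule sum_abs)
  also have "\<dots> \<le> (\<Sum>x\<in>\<Omega>. (\<Sum>x\<in>\<Omega>. \<bar>F x\<bar>) * exp (C x + \<theta> * F x))"
    using finite by (intro sum_mono) (auto simp: abs_mult intro!: mult_right_mono member_le_sum)
  also have "\<dots> = (\<Sum>x\<in>\<Omega>. \<bar>F x\<bar>) * moment 0 \<theta>"
    by (simp add: moment_def sum_distrib_left)
  finally show ?thesis
    using moment_0_pos [of \<theta>] by (simp add: mean_def field_simps)
qed

lemma mean_1_mono: "s \<le> t \<Longrightarrow> mean 1 s \<le> mean 1 t"
  by (erule DERIV_nonneg_imp_nondecreasing)
    (blast intro: has_derivative_mean_1 less_imp_le [OF fisher_pos])

text \<open>Otherwise \<open>mean 1\<close>, whose derivative is \<open>fisher\<close>, would be unbounded.\<close>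

lemma fisher_ge_on_half_line_False:
  assumes "(\<forall>t\<ge>0. fisher t \<ge> fisher 0) \<or> (\<forall>t\<le>0. fisher t \<ge> fisher 0)"
  shows False
proof -
  define B where "B = (\<Sum>x\<in>\<Omega>. \<bar>F x\<bar>)"
  \<comment> \<open>On an interval of length \<open>T\<close> with slope at least
    \<open>fisher 0\<close>, \<open>mean 1\<close> grows by at least \<open>2 * B + 1\<close>, more
    than its bound \<open>B\<close> in absolute value permits.\<close>
  define T where "T = (2 * B + 1) / fisher 0"
  have "B \<ge> 0" unfolding B_def by (simp add: sum_nonneg)
  then have "T > 0" using fisher_pos [of 0] by (simp add: T_def)
  obtain s t where st: "s < t" "t - s = T" "\<forall>x. s \<le> x \<and> x \<le> t \<longrightarrow> fisher x \<ge> fisher 0"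
    using assms
  proof
    assume "\<forall>t\<ge>0. fisher t \<ge> fisher 0"
    then show thesis using \<open>T > 0\<close> by (intro that [of 0 T]) auto
  next
    assume "\<forall>t\<le>0. fisher t \<ge> fisher 0"
    then show thesis using \<open>T > 0\<close> by (intro that [of "-T" 0]) auto
  qed
  obtain z where z: "s < z" "z < t" "mean 1 t - mean 1 s = (t - s) * fisher z"
    using MVT2 [OF st(1) has_derivative_mean_1] by blast
  have "2 * B + 1 = T * fisher 0" using fisher_pos [of 0] by (simp add: T_def)
  also have "\<dots> \<le> T * fisher z"
    using st(3) [rule_format, of z] z \<open>T > 0\<close> by (intro mult_left_mono) auto
  also have "\<dots> = mean 1 t - mean 1 s" using st(2) z(3) by simp
  also have "\<dots> \<le> 2 * B" using abs_mean_1_le [of s] abs_mean_1_le [of t] by (simp add: B_def)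
  finally show False by simp
qed

section \<open>Steps between the values of \<open>F\<close>\<close>

text \<open>Clearing the denominator \<open>moment 0\<close> turns \<open>rel\<close> into a
  vanishing sum of exponentials, whose coefficients link the total weight \<open>?w\<close> at
  \<open>s\<close> with that at \<open>s - \<delta>\<close>.\<close>

lemma exponents_of_linear_relation:
  assumes rel: "\<And>\<theta>. mean 1 \<theta> - r1 = K * exp (\<delta> * \<theta>) * (r2 - mean 1 \<theta>)"
    and "K \<noteq> 0" and "f \<in> F ` \<Omega>"
  shows "f \<noteq> r1 \<Longrightarrow> f - \<delta> \<in> F ` \<Omega>" and "f \<noteq> r2 \<Longrightarrow> f + \<delta> \<in> F ` \<Omega>"
proof -
  \<comment> \<open>The left copy of \<open>\<Omega>\<close> carries the terms of
    \<open>mean 1 \<theta> - r1\<close>; the right copy carries those of the other side, with its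
    sign reversed and exponents shifted by \<open>\<delta>\<close>.\<close>
  let ?d = "case_sum (\<lambda>x. exp (C x) * (F x - r1)) (\<lambda>x. K * exp (C x) * (F x - r2))"
  let ?g = "case_sum F (\<lambda>x. F x + \<delta>)"
  let ?I = "\<Omega> <+> \<Omega>"
  let ?w = "\<lambda>s. \<Sum>x\<in>{x\<in>\<Omega>. F x = s}. exp (C x)"
  have "(\<Sum>i\<in>?I. ?d i * exp (\<theta> * ?g i)) = 0" for \<theta>
  proof -
    have "moment 1 \<theta> - r1 * moment 0 \<theta>
        = K * exp (\<delta> * \<theta>) * (r2 * moment 0 \<theta> - moment 1 \<theta>)"
      using rel [of \<theta>] by (simp add: mean_def field_simps)
    moreover have "(\<Sum>i\<in>?I. ?d i * exp (\<theta> * ?g i))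
        = (moment 1 \<theta> - r1 * moment 0 \<theta>)
          - K * exp (\<delta> * \<theta>) * (r2 * moment 0 \<theta> - moment 1 \<theta>)"
      using finite
      by (simp add: sum.Plus moment_def sum_distrib_left sum_subtractf [symmetric]
          sum.distrib [symmetric] exp_add algebra_simps)
    ultimately show ?thesis by simp
  qed
  then have fiber: "(\<Sum>i\<in>{i\<in>?I. ?g i = s}. ?d i) = 0" for s
    using finite by (intro exp_sum_eq_0_imp_fiber_sum_eq_0) auto
  have rec: "(s - r1) * ?w s = K * (r2 - (s - \<delta>)) * ?w (s - \<delta>)" for s
  proof -
    have "{i\<in>?I. ?g i = s} = {x\<in>\<Omega>. F x = s} <+> {x\<in>\<Omega>. F x = s - \<delta>}"
      by (auto simp: Plus_def)
    then have "0 = (\<Sum>x\<in>{x\<in>\<Omega>. F x = s}. exp (C x) * (F x - r1))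
        + (\<Sum>x\<in>{x\<in>\<Omega>. F x = s - \<delta>}. K * exp (C x) * (F x - r2))"
      using fiber [of s] finite by (simp add: sum.Plus)
    also have "(\<Sum>x\<in>{x\<in>\<Omega>. F x = s}. exp (C x) * (F x - r1)) = (s - r1) * ?w s"
      by (simp add: sum_distrib_left mult.commute)
    also have "(\<Sum>x\<in>{x\<in>\<Omega>. F x = s - \<delta>}. K * exp (C x) * (F x - r2))
        = K * ((s - \<delta>) - r2) * ?w (s - \<delta>)"
      by (simp add: sum_distrib_left mult_ac)
    finally show ?thesis by (simp add: algebra_simps)
  qed
  have w_zero_iff: "?w s = 0 \<longleftrightarrow> s \<notin> F ` \<Omega>" for s
    using finite by (subst sum_nonneg_eq_0_iff) auto
  \<comment> \<open>The recurrence at \<open>f\<close> has a nonzero left side, so the weight at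
    \<open>f - \<delta>\<close> is nonzero. For \<open>f + \<delta>\<close> it is read from right to
    left, using \<open>K \<noteq> 0\<close>.\<close>
  show "f - \<delta> \<in> F ` \<Omega>" if "f \<noteq> r1"
    using rec [of f] w_zero_iff [of f] w_zero_iff [of "f - \<delta>"] that assms by auto
  show "f + \<delta> \<in> F ` \<Omega>" if "f \<noteq> r2"
    using rec [of "f + \<delta>"] w_zero_iff [of f] w_zero_iff [of "f + \<delta>"] that assms by auto
qed

section \<open>The differential equation forced by constant curvature\<close>

lemma constant_curvature_imp_riccati:
  assumes "\<And>q r. scal_tangent_bundle \<Omega> C F q r = lam"
  obtains a c where "\<And>\<theta>. fisher' \<theta> = (a - lam * mean 1 \<theta>) * fisher \<theta>"
    and "\<And>\<theta>. fisher \<theta> = c + a * mean 1 \<theta> - lam / 2 * (mean 1 \<theta>)\<^sup>2"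
proof -
  obtain fisher'' where fisher'': "\<And>\<theta>. (fisher' has_real_derivative fisher'' \<theta>) (at \<theta>)"
    using has_derivative_fisher' by blast
  have nz: "fisher \<theta> \<noteq> 0" for \<theta> using fisher_pos [of \<theta>] by simp
  have lam: "(fisher' \<theta>)\<^sup>2 - fisher \<theta> * fisher'' \<theta> = lam * fisher \<theta> ^ 3" for \<theta>
    using assms [of \<theta> 0] nz [of \<theta>]
      scalar_curvature_conformal [OF fisher_pos has_derivative_fisher fisher'', of "vector [\<theta>, 0]"]
    by (simp add: scal_tangent_bundle_def fisher_metric_eq field_simps)
  \<comment> \<open>First integral: \<open>fisher' / fisher\<close> is \<open>(ln h)'\<close>, with
    derivative \<open>- lam * fisher\<close>, and \<open>fisher\<close> is the derivative of
    \<open>mean 1\<close>.\<close>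
  have "((\<lambda>t. fisher' t / fisher t + lam * mean 1 t) has_real_derivative 0) (at \<theta>)" for \<theta>
  proof -
    have "((\<lambda>t. fisher' t / fisher t + lam * mean 1 t) has_real_derivative
        (fisher'' \<theta> * fisher \<theta> - fisher' \<theta> * fisher' \<theta>) / (fisher \<theta> * fisher \<theta>) + lam * fisher \<theta>) (at \<theta>)"
      using nz by (auto intro!: derivative_eq_intros fisher'' has_derivative_fisher has_derivative_mean_1)
    moreover have "fisher'' \<theta> * fisher \<theta> - fisher' \<theta> * fisher' \<theta> = - lam * fisher \<theta> ^ 3"
      using lam [of \<theta>] by (simp add: power2_eq_square algebra_simps)
    ultimately show ?thesis using nz [of \<theta>] by (simp add: field_simps power3_eq_cube)
  qed
  then obtain a where "fisher' \<theta> / fisher \<theta> + lam * mean 1 \<theta> = a" for \<theta>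
    by (rule zero_derivative_imp_constant) blast
  then have a: "fisher' \<theta> = (a - lam * mean 1 \<theta>) * fisher \<theta>" for \<theta>
    using nz by (simp add: field_simps)
  \<comment> \<open>Second integral: \<open>(a - lam * mean 1) * fisher\<close> is the derivative of
    a quadratic in \<open>mean 1\<close>.\<close>
  have "((\<lambda>t. fisher t - (a * mean 1 t - lam / 2 * (mean 1 t)\<^sup>2)) has_real_derivative 0) (at \<theta>)" for \<theta>
    by (auto intro!: derivative_eq_intros has_derivative_fisher has_derivative_mean_1
        simp: a algebra_simps)
  then obtain c where "fisher \<theta> - (a * mean 1 \<theta> - lam / 2 * (mean 1 \<theta>)\<^sup>2) = c" for \<theta>
    by (rule zero_derivative_imp_constant) blast
  then have "fisher \<theta> = c + a * mean 1 \<theta> - lam / 2 * (mean 1 \<theta>)\<^sup>2" for \<theta>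
    by (simp add: algebra_simps)
  with a show thesis using that by blast
qed

text \<open>For \<open>lam \<le> 0\<close> the logarithmic slope \<open>a - lam * mean 1\<close> is
  nondecreasing. Its sign at \<open>0\<close> decides on which half line \<open>fisher\<close> stays
  above \<open>fisher 0\<close>.\<close>

lemma constant_curvature_pos:
  assumes a: "\<And>\<theta>. fisher' \<theta> = (a - lam * mean 1 \<theta>) * fisher \<theta>"
  shows "lam > 0"
proof (rule ccontr)
  assume "\<not> lam > 0"
  then have slope_mono: "a - lam * mean 1 s \<le> a - lam * mean 1 t" if "s \<le> t" for s t
    using mean_1_mono [OF that] by (simp add: mult_left_mono_neg)
  show False
  proof (cases "a - lam * mean 1 0 \<ge> 0")
    case True
    then have "fisher' t \<ge> 0" if "t \<ge> 0" for t
      using slope_mono [OF that] fisher_pos [of t] by (simp add: a)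
    then have "fisher t \<ge> fisher 0" if "t \<ge> 0" for t
      using that has_derivative_fisher by (intro DERIV_nonneg_imp_nondecreasing [OF that]) blast
    then show False using fisher_ge_on_half_line_False by blast
  next
    case False
    then have "fisher' t \<le> 0" if "t \<le> 0" for t
      using slope_mono [OF that] fisher_pos [of t] by (simp add: a mult_nonpos_nonneg)
    then have "fisher t \<ge> fisher 0" if "t \<le> 0" for t
      using that has_derivative_fisher by (intro DERIV_nonpos_imp_nonincreasing [OF that]) blast
    then show False using fisher_ge_on_half_line_False by blast
  qed
qed

lemma constant_curvature_values:
  assumes "\<And>q r. scal_tangent_bundle \<Omega> C F q r = lam"
  obtains k :: nat where "lam = 2 / real k" "1 \<le> k" "k + 1 \<le> card \<Omega>"
proof -
  obtain a c where a: "\<And>\<theta>. fisher' \<theta> = (a - lam * mean 1 \<theta>) * fisher \<theta>"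
    and c: "\<And>\<theta>. fisher \<theta> = c + a * mean 1 \<theta> - lam / 2 * (mean 1 \<theta>)\<^sup>2"
    using constant_curvature_imp_riccati [OF assms] by blast
  have "lam > 0" using constant_curvature_pos [OF a] .
  \<comment> \<open>The root of the discriminant of the Riccati quadratic, whose zeros are
    \<open>r1\<close> and \<open>r2\<close>. The discriminant is positive because it exceeds
    \<open>2 * lam * fisher 0\<close> by a square.\<close>
  define \<delta> where "\<delta> = sqrt (a\<^sup>2 + 2 * lam * c)"
  define r1 where "r1 = (a - \<delta>) / lam"
  define r2 where "r2 = (a + \<delta>) / lam"
  have completed_square: "2 * lam * fisher \<theta> = a\<^sup>2 + 2 * lam * c - (lam * mean 1 \<theta> - a)\<^sup>2" for \<theta>
    by (simp add: c power2_eq_square algebra_simps)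
  have "2 * lam * fisher 0 > 0" using \<open>lam > 0\<close> fisher_pos [of 0] by simp
  then have disc: "a\<^sup>2 + 2 * lam * c > 0"
    unfolding completed_square using zero_le_power2 [of "lam * mean 1 0 - a"] by linarith
  then have "\<delta> > 0" and \<delta>2: "\<delta>\<^sup>2 = a\<^sup>2 + 2 * lam * c" by (simp_all add: \<delta>_def)
  have lam_r: "lam * r1 = a - \<delta>" "lam * r2 = a + \<delta>"
    using \<open>lam > 0\<close> by (simp_all add: r1_def r2_def)
  have "r1 < r2" and \<delta>_eq: "\<delta> = lam / 2 * (r2 - r1)"
    using \<open>\<delta> > 0\<close> \<open>lam > 0\<close> by (simp_all add: r1_def r2_def field_simps)
  have fisher_eq: "fisher \<theta> = lam / 2 * (mean 1 \<theta> - r1) * (r2 - mean 1 \<theta>)" for \<theta>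
  proof -
    have "2 * lam * (lam / 2 * (mean 1 \<theta> - r1) * (r2 - mean 1 \<theta>))
        = (lam * mean 1 \<theta> - lam * r1) * (lam * r2 - lam * mean 1 \<theta>)"
      by (simp add: field_simps)
    also have "\<dots> = \<delta>\<^sup>2 - (lam * mean 1 \<theta> - a)\<^sup>2"
      unfolding lam_r by (simp add: power2_eq_square algebra_simps)
    also have "\<dots> = 2 * lam * fisher \<theta>"
      by (simp only: \<delta>2 completed_square)
    finally show ?thesis using \<open>lam > 0\<close> by simp
  qed
  have between: "r1 < mean 1 \<theta> \<and> mean 1 \<theta> < r2" for \<theta>
  proof -
    have "0 < (mean 1 \<theta> - r1) * (r2 - mean 1 \<theta>)"
    proof (rule zero_less_mult_pos)
      show "0 < lam / 2 * ((mean 1 \<theta> - r1) * (r2 - mean 1 \<theta>))"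
        using fisher_pos [of \<theta>] by (simp only: fisher_eq mult.assoc)
    qed (use \<open>lam > 0\<close> in simp)
    \<comment> \<open>Both factors have the same sign; both negative would give
      \<open>r2 < r1\<close>.\<close>
    then show ?thesis using \<open>r1 < r2\<close> by (auto simp: zero_less_mult_iff)
  qed
  \<comment> \<open>Separation of variables: the logarithm of the quotient has constant derivative
    \<open>\<delta>\<close>, so the factor \<open>exp (- \<delta> * t)\<close> makes it
    constant.\<close>
  have "((\<lambda>t. (mean 1 t - r1) / (r2 - mean 1 t) * exp (- \<delta> * t)) has_real_derivative 0) (at \<theta>)" for \<theta>
  proof -
    let ?v = "r2 - mean 1 \<theta>"
    have "?v \<noteq> 0" using between [of \<theta>] by simp
    have "fisher \<theta> * (r2 - r1) = \<delta> * (mean 1 \<theta> - r1) * ?v"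
      by (simp only: fisher_eq \<delta>_eq mult_ac)
    then have slope: "(fisher \<theta> * ?v - (mean 1 \<theta> - r1) * (- fisher \<theta>)) / (?v * ?v)
        = \<delta> * ((mean 1 \<theta> - r1) / ?v)"
      using \<open>?v \<noteq> 0\<close> by (simp add: nonzero_divide_eq_eq) (simp add: algebra_simps)
    have "((\<lambda>t. (mean 1 t - r1) / (r2 - mean 1 t)) has_real_derivative
        (fisher \<theta> * ?v - (mean 1 \<theta> - r1) * (- fisher \<theta>)) / (?v * ?v)) (at \<theta>)"
      using \<open>?v \<noteq> 0\<close> by (auto intro!: derivative_eq_intros has_derivative_mean_1)
    note quotient = this [unfolded slope]
    show ?thesis
      by (rule derivative_eq_intros quotient refl)+ simp
  qed
  then obtain K where K: "(mean 1 \<theta> - r1) / (r2 - mean 1 \<theta>) * exp (- \<delta> * \<theta>) = K" for \<theta>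
    by (rule zero_derivative_imp_constant) blast
  have "K \<noteq> 0" using K [of 0] between [of 0] by auto
  have rel: "mean 1 \<theta> - r1 = K * exp (\<delta> * \<theta>) * (r2 - mean 1 \<theta>)" for \<theta>
  proof -
    have "K * exp (\<delta> * \<theta>) = (mean 1 \<theta> - r1) / (r2 - mean 1 \<theta>)"
      unfolding K [of \<theta>, symmetric] by (simp add: mult_exp_exp)
    then show ?thesis using between [of \<theta>] by simp
  qed
  obtain k where k: "r2 = r1 + real k * \<delta>" "k + 1 \<le> card (F ` \<Omega>)"
  proof (rule finite_progression [of "F ` \<Omega>" \<delta> r2 r1])
    show "F ` \<Omega> \<noteq> {}" using nonconstant by blast
  qed (use finite \<open>\<delta> > 0\<close> exponents_of_linear_relation [OF rel \<open>K \<noteq> 0\<close>] in auto)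
  \<comment> \<open>Substitute \<open>\<delta> = lam / 2 * (r2 - r1)\<close> into
    \<open>r2 - r1 = real k * \<delta>\<close>, then cancel \<open>r2 - r1\<close>.\<close>
  have "(r2 - r1) * (real k * lam) = (r2 - r1) * 2"
    using k(1) \<delta>_eq by (simp add: field_simps)
  then have "real k * lam = 2" using \<open>r1 < r2\<close> by (simp only: mult_left_cancel)
  moreover from this have "k \<noteq> 0" by (intro notI) simp
  ultimately have "lam = 2 / real k" by (simp add: field_simps)
  moreover have "1 \<le> k" using \<open>k \<noteq> 0\<close> by simp
  moreover have "k + 1 \<le> card \<Omega>"
    using k(2) card_image_le [OF finite, of F] by (rule order_trans)
  ultimately show thesis by (rule that)
qed

end

theorem corollary7p10:
  fixes \<Omega> :: "'a set" and m :: nat and C F :: "'a \<Rightarrow> real" and lam :: real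
  assumes "exponential_family_1 \<Omega> C F"
    and "card \<Omega> = m + 1"
    and "\<forall>q r. scal_tangent_bundle \<Omega> C F q r = lam"
  shows "lam \<in> {2 / real_of_int k | k :: int. 1 \<le> k \<and> k \<le> int m}"
proof -
  have "\<exists>x\<in>\<Omega>. F x \<noteq> c" for c
  proof (rule ccontr)
    assume "\<not> ?thesis"
    \<comment> \<open>A constant \<open>F\<close> would satisfy a linear relation with coefficients
      \<open>1\<close> and \<open>- c\<close>; this also rules out empty
      \<open>\<Omega>\<close>.\<close>
    then have "\<forall>x\<in>\<Omega>. 1 * F x + (- c) * 1 = 0" by simp
    then have "(1::real) = 0" using assms(1) unfolding exponential_family_1_def by blast
    then show False by simp
  qed
  then interpret nonconstant_statistic \<Omega> C F
    using assms(1) by unfold_locales (auto simp: exponential_family_1_def)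
  obtain k :: nat where "lam = 2 / real k" "1 \<le> k" "k + 1 \<le> card \<Omega>"
    using constant_curvature_values assms(3) by blast
  \<comment> \<open>The progression has \<open>k + 1\<close> points among at most
    \<open>m + 1\<close> values of \<open>F\<close>, whence \<open>k \<le> m\<close>.\<close>
  then have "lam = 2 / real_of_int (int k) \<and> 1 \<le> int k \<and> int k \<le> int m"
    using assms(2) by simp
  then show ?thesis by blast
qed

end
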